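(* Let $n\ge 3$ be odd and $t>0$. The relation $\stackrel{t}{\sim}$ on plane $n$-gons is symplectic with respect to $\omega$, that is, $q_t^*(\omega)=r_t^*(\omega)$.
   Context: A plane $n$-gon is an $n$-tuple $\mathbf{P}=(P_1,\dots,P_n)$ of points $P_i=(x_i,y_i)\in\mathbb{R}^2$, indices cyclic mod $n$. On the space of $n$-gons with $P_i\neq P_{i+1}$ for all $i$, define $q_t(\mathbf{P})=\mathbf{Q}$ and $r_t(\mathbf{P})=\mathbf{R}$ by $$Q_i=P_i+t\frac{P_i-P_{i-1}}{|P_i-P_{i-1}|},\qquad R_i=P_i+t\frac{P_i-P_{i+1}}{|P_i-P_{i+1}|}.$$ The relation $\mathbf{Q}\stackrel{t}{\sim}\mathbf{R}$ means that $\mathbf{Q}=q_t(\mathbf{P})$, $\mathbf{R}=r_t(\mathbf{P})$ for some such $\mathbf{P}$. The 2-form is $$\omega=\sum_{1\le i<j\le n}(-1)^{i+j-1}(dx_i\wedge dx_j+dy_i\wedge dy_j);$$ for odd $n$ its kernel is spanned by the diagonal parallel translations, so it induces a symplectic form on the quotient of the space of $n$-gons by parallel translations. *)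

theory Defs
  imports "HOL-Analysis.Analysis" "Berlekamp_Zassenhaus.Finite_Field"
begin

text \<open>
  A plane \<open>n\<close>-gon with \<open>n = CARD('n)\<close> is a family of points of the plane indexed by the ring of
  integers modulo \<open>n\<close>, so \<open>i - 1\<close> and \<open>i + 1\<close> are the cyclic neighbours of \<open>i\<close>. The vertex with
  label \<open>k \<in> {1..n}\<close> has index \<open>of_nat k\<close>; in particular label \<open>n\<close> has index \<open>0\<close>.
\<close>
type_synonym 'n ngon = "(real ^ 2) ^ 'n mod_ring"

definition nondeg_ngons :: "('n::nontriv) ngon set" where
  "nondeg_ngons = {P. \<forall>i. P $ i \<noteq> P $ (i + 1)}"

definition q_map :: "real \<Rightarrow> ('n::nontriv) ngon \<Rightarrow> 'n ngon" where
  "q_map t P = (\<chi> i. P $ i + t *\<^sub>R ((P $ i - P $ (i - 1)) /\<^sub>R norm (P $ i - P $ (i - 1))))"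

definition r_map :: "real \<Rightarrow> ('n::nontriv) ngon \<Rightarrow> 'n ngon" where
  "r_map t P = (\<chi> i. P $ i + t *\<^sub>R ((P $ i - P $ (i + 1)) /\<^sub>R norm (P $ i - P $ (i + 1))))"

text \<open>
  Differential forms on a normed space: the first argument is the base point, the remaining ones
  are tangent vectors.
\<close>
type_synonym 'a form1 = "'a \<Rightarrow> 'a \<Rightarrow> real"
type_synonym 'a form2 = "'a \<Rightarrow> 'a \<Rightarrow> 'a \<Rightarrow> real"

definition wedge :: "'a form1 \<Rightarrow> 'a form1 \<Rightarrow> 'a form2" where
  "wedge \<alpha> \<beta> p u v = \<alpha> p u * \<beta> p v - \<alpha> p v * \<beta> p u"

text \<open>
  The map \<open>f\<close> has to be differentiable at \<open>p\<close> for this to be meaningful; for the two maps above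
  see the lemmas at the end.
\<close>
definition pullback ::
  "('a::real_normed_vector \<Rightarrow> 'b::real_normed_vector) \<Rightarrow> 'b form2 \<Rightarrow> 'a form2" where
  "pullback f \<eta> p u v = \<eta> (f p) (frechet_derivative f (at p) u) (frechet_derivative f (at p) v)"

definition dx :: "nat \<Rightarrow> ('n::nontriv) ngon form1" where
  "dx k P u = u $ of_nat k $ 1"

definition dy :: "nat \<Rightarrow> ('n::nontriv) ngon form1" where
  "dy k P u = u $ of_nat k $ 2"

definition omega :: "('n::nontriv) ngon form2" where
  "omega P u v = (\<Sum>j = 1..CARD('n). \<Sum>i = 1..<j.
     (- 1) ^ (i + j - 1) * (wedge (dx i) (dx j) P u v + wedge (dy i) (dy j) P u v))"

lemma open_nondeg_ngons: "open (nondeg_ngons :: ('n::nontriv) ngon set)"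
proof -
  have "nondeg_ngons = (\<Inter>i. {P :: 'n ngon. P $ i \<noteq> P $ (i + 1)})"
    by (auto simp: nondeg_ngons_def)
  moreover have "open (\<Inter>i. {P :: 'n ngon. P $ i \<noteq> P $ (i + 1)})"
    by (intro open_INT finite ballI open_Collect_neq continuous_intros)
  ultimately show ?thesis
    by metis
qed

lemma differentiable_unit_edge:
  fixes P :: "('n::nontriv) ngon"
  assumes "P $ i \<noteq> P $ j"
  shows "(\<lambda>P. P $ i + t *\<^sub>R ((P $ i - P $ j) /\<^sub>R norm (P $ i - P $ j))) differentiable at P"
proof -
  have lin: "(\<lambda>P :: 'n ngon. P $ k) differentiable at P" for k
    by (intro bounded_linear_imp_differentiable bounded_linear_vec_nth)
  have diff: "(\<lambda>P :: 'n ngon. P $ i - P $ j) differentiable at P"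
    by (intro differentiable_diff lin)
  have "norm differentiable at (P $ i - P $ j)"
    using assms by (intro differentiable_norm_at) auto
  then have "(\<lambda>P :: 'n ngon. norm (P $ i - P $ j)) differentiable at P"
    using differentiable_chain_at[OF diff] by (simp add: o_def)
  then have "(\<lambda>P :: 'n ngon. inverse (norm (P $ i - P $ j))) differentiable at P"
    using assms by (intro differentiable_inverse) auto
  then show ?thesis
    by (intro differentiable_add differentiable_scaleR differentiable_const lin diff)
qed

lemma differentiable_vec_lambda:
  fixes f :: "'a::real_normed_vector \<Rightarrow> 'b::euclidean_space ^ 'm"
  assumes "\<And>i. (\<lambda>x. f x $ i) differentiable at x"
  shows "f differentiable at x"
proof -
  have "(\<lambda>x. f x \<bullet> b) differentiable at x" if b_Basis: "b \<in> Basis" for b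
  proof -
    obtain i c where b: "b = axis i c"
      using b_Basis unfolding Basis_vec_def by blast
    show ?thesis
      unfolding b inner_axis by (intro differentiable_inner assms differentiable_const)
  qed
  then show ?thesis
    by (subst differentiable_componentwise_within) auto
qed

lemma q_map_differentiable:
  assumes "P \<in> nondeg_ngons"
  shows "q_map t differentiable at P"
proof (rule differentiable_vec_lambda)
  fix i
  have "P $ (i - 1) \<noteq> P $ (i - 1 + 1)"
    using assms unfolding nondeg_ngons_def by blast
  then show "(\<lambda>P. q_map t P $ i) differentiable at P"
    using differentiable_unit_edge[of P i "i - 1" t] by (simp add: q_map_def)
qed

lemma r_map_differentiable:
  assumes "P \<in> nondeg_ngons"
  shows "r_map t differentiable at P"
proof (rule differentiable_vec_lambda)
  fix i
  show "(\<lambda>P. r_map t P $ i) differentiable at P"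
    using assms differentiable_unit_edge[of P i "i + 1" t]
    by (simp add: r_map_def nondeg_ngons_def)
qed

end

(* With e_i the unit vector from P_i to P_(i+1), Q_i = P_i + t e_(i-1) and R_i = P_i - t e_i, so
   Q_i - R_i = t (e_(i-1) + e_i). Against the alternating signs of omega these sums telescope, and
   for odd n the boundary terms cancel: contracting omega with (e_(i-1) + e_i)_i gives
   (e_(i-1) - e_i)_i. Polarization then leaves only the term of order t in the difference of the two
   pullbacks. Summed by parts, that term vanishes because de_i is a symmetric function (the Hessian
   of the norm) of the differential of P_(i+1) - P_i. *)

theory Submission
  imports Defs
begin

text \<open>For nonzero \<open>x\<close> this is the Hessian of the norm at \<open>x\<close> applied
  to \<open>h\<close>: the part of \<open>h\<close> orthogonal to \<open>x\<close>, divided by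
  \<open>norm x\<close>.\<close>

definition sgn_deriv :: "'a::real_inner \<Rightarrow> 'a \<Rightarrow> 'a" where
  "sgn_deriv x h = h /\<^sub>R norm x - ((x \<bullet> h) / norm x ^ 3) *\<^sub>R x"

lemma has_derivative_sgn:
  fixes x :: "'a::real_inner"
  assumes "x \<noteq> 0"
  shows "(sgn has_derivative sgn_deriv x) (at x)"
proof -
  have *: "((\<lambda>x::'a. x /\<^sub>R norm x) has_derivative sgn_deriv x) (at x)"
    using assms
    by (auto intro!: derivative_eq_intros has_derivative_norm[THEN has_derivative_eq_rhs]
        simp: sgn_deriv_def fun_eq_iff sgn_div_norm inner_commute power3_eq_cube divide_simps)
  then show ?thesis
    by (simp add: sgn_div_norm[abs_def])
qed

lemma sgn_deriv_symmetric: "h \<bullet> sgn_deriv x k = k \<bullet> sgn_deriv x h"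
  by (simp add: sgn_deriv_def inner_diff_right inner_commute algebra_simps)

lemma sgn_deriv_minus: "sgn_deriv (- x) (- h) = - sgn_deriv x h"
  by (simp add: sgn_deriv_def)

lemma has_derivative_vec_lambda:
  fixes f :: "'a::real_normed_vector \<Rightarrow> 'b::euclidean_space ^ 'm"
  assumes "\<And>i. ((\<lambda>x. f x $ i) has_derivative (\<lambda>h. f' h $ i)) (at x)"
  shows "(f has_derivative f') (at x)"
proof -
  have "((\<lambda>x. f x \<bullet> b) has_derivative (\<lambda>h. f' h \<bullet> b)) (at x)" if b_Basis: "b \<in> Basis" for b
  proof -
    obtain i c where b: "b = axis i c"
      using b_Basis unfolding Basis_vec_def by blast
    show ?thesis
      unfolding b inner_axis by (intro has_derivative_inner_left assms)
  qed
  then show ?thesis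
    by (subst has_derivative_componentwise_within) auto
qed

text \<open>The labels 1 to n meet every residue, hence, by counting, each exactly once. This trades
  sums over labels for cyclic sums, where shifting the index is free.\<close>

lemma sum_of_nat_mod_ring:
  fixes f :: "'n::nontriv mod_ring \<Rightarrow> 'b::comm_monoid_add"
  shows "(\<Sum>k = 1..CARD('n). f (of_nat k)) = sum f UNIV"
proof -
  have "UNIV \<subseteq> (of_nat :: nat \<Rightarrow> 'n mod_ring) ` {1..CARD('n)}"
  proof
    fix x :: "'n mod_ring"
    have x: "x = of_nat (nat (to_int_mod_ring x))" "nat (to_int_mod_ring x) < CARD('n)"
      using range_to_int_mod_ring[where 'a='n] rangeI[of to_int_mod_ring x]
      by (auto simp: of_nat_of_int_mod_ring)
    show "x \<in> of_nat ` {1..CARD('n)}"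
    proof (cases "nat (to_int_mod_ring x) = 0")
      case True
      \<comment> \<open>Labels start at 1, so residue 0 has to come from label n.\<close>
      then have "x = of_nat CARD('n)" using x(1) by simp
      then show ?thesis by (intro image_eqI[of _ _ "CARD('n)"]) (simp_all add: Suc_leI)
    next
      case False
      then have "nat (to_int_mod_ring x) \<in> {1..CARD('n)}" using x(2) by simp
      then show ?thesis by (rule image_eqI[where f = of_nat, OF x(1)])
    qed
  qed
  then have im: "(of_nat :: nat \<Rightarrow> 'n mod_ring) ` {1..CARD('n)} = UNIV" by blast
  have "inj_on (of_nat :: nat \<Rightarrow> 'n mod_ring) {1..CARD('n)}"
    by (rule eq_card_imp_inj_on) (simp, unfold im, simp)
  then show ?thesis
    using sum.reindex[of of_nat "{1..CARD('n)}" f] im by simp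
qed

text \<open>The form \<open>omega\<close> with scalar product in place of the two coordinates, on sequences that
  need not be periodic.\<close>
definition alt_form :: "nat \<Rightarrow> (nat \<Rightarrow> 'a::real_inner) \<Rightarrow> (nat \<Rightarrow> 'a) \<Rightarrow> real" where
  "alt_form n a b = (\<Sum>j = 1..n. \<Sum>i = 1..<j. (- 1) ^ (i + j - 1) * (a i \<bullet> b j - b i \<bullet> a j))"

lemma alt_form_0 [simp]: "alt_form 0 a b = 0"
  by (simp add: alt_form_def)

text \<open>Split off the outer index n + 1: its sign factors as
  \<open>(- 1) ^ n * (- 1) ^ i\<close>, which leaves plain alternating sums over i.\<close>

lemma alt_form_Suc:
  "alt_form (Suc n) a b = alt_form n a b +
     (- 1) ^ n * ((\<Sum>i = 1..n. (- 1) ^ i *\<^sub>R a i) \<bullet> b (Suc n) - (\<Sum>i = 1..n. (- 1) ^ i *\<^sub>R b i) \<bullet> a (Suc n))"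
  by (simp add: alt_form_def atLeastLessThanSuc_atLeastAtMost inner_sum_left sum_subtractf[symmetric]
      sum_distrib_left power_add algebra_simps del: sum_subtractf)

lemma alt_form_add_left: "alt_form n (\<lambda>i. a i + a' i) b = alt_form n a b + alt_form n a' b"
  by (simp add: alt_form_def sum.distrib[symmetric] inner_simps algebra_simps)

lemma alt_form_diff_left: "alt_form n (\<lambda>i. a i - a' i) b = alt_form n a b - alt_form n a' b"
  by (simp add: alt_form_def sum_subtractf[symmetric] inner_simps algebra_simps del: sum_subtractf)

lemma alt_form_swap: "alt_form n a b = - alt_form n b a"
  by (simp add: alt_form_def sum_negf[symmetric] algebra_simps del: sum_negf)

lemma alt_form_scaleR_left: "alt_form n (\<lambda>i. c *\<^sub>R a i) b = c * alt_form n a b"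
  by (simp add: alt_form_def sum_distrib_left algebra_simps)

lemma sum_alternating_adjacent:
  fixes e :: "nat \<Rightarrow> 'a::real_vector"
  shows "(\<Sum>i = 1..n. (- 1) ^ i *\<^sub>R (e (i - 1) + e i)) = (- 1) ^ n *\<^sub>R e n - e 0"
  by (induction n) (auto simp: algebra_simps)

text \<open>Induction on n, each new row being telescoped by
  \<open>sum_alternating_adjacent\<close>. Initial segments of a periodic sequence are not periodic,
  so the boundary vectors \<open>e 0\<close> and \<open>e n\<close> are kept in the first
  term.\<close>

lemma alt_form_adjacent:
  "alt_form n (\<lambda>i. e (i - 1) + e i) c =
     (e 0 + (- 1) ^ n *\<^sub>R e n) \<bullet> (\<Sum>j = 1..n. (- 1) ^ j *\<^sub>R c j) - (\<Sum>j = 1..n. (e j - e (j - 1)) \<bullet> c j)"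
proof (induction n)
  case (Suc n)
  have "(- 1 :: real) ^ n * (- 1) ^ n = 1"
    by (simp flip: power_mult_distrib)
  then show ?case
    unfolding alt_form_Suc Suc sum_alternating_adjacent
    by (simp add: inner_simps inner_commute[of "sum _ _"] algebra_simps)
qed simp

text \<open>The boundary factor is \<open>e 0 - e n\<close>, which vanishes by periodicity.\<close>

lemma alt_form_adjacent_odd:
  assumes "odd n" and "e n = e 0"
  shows "alt_form n (\<lambda>i. e (i - 1) + e i) c = (\<Sum>j = 1..n. (e (j - 1) - e j) \<bullet> c j)"
  unfolding alt_form_adjacent using assms by (simp add: inner_diff_left sum_subtractf)

lemma alt_form_shift_diff:
  fixes u v e f :: "nat \<Rightarrow> 'a::real_inner"
  assumes n: "odd n" and e: "e n = e 0" and f: "f n = f 0"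
  shows "alt_form n (\<lambda>i. u i + t *\<^sub>R e (i - 1)) (\<lambda>i. v i + t *\<^sub>R f (i - 1)) -
         alt_form n (\<lambda>i. u i - t *\<^sub>R e i) (\<lambda>i. v i - t *\<^sub>R f i) =
         t * ((\<Sum>j = 1..n. (e (j - 1) - e j) \<bullet> v j) - (\<Sum>j = 1..n. (f (j - 1) - f j) \<bullet> u j))"
proof -
  define q q' r r' where defs: "q = (\<lambda>i. u i + t *\<^sub>R e (i - 1))" "q' = (\<lambda>i. v i + t *\<^sub>R f (i - 1))"
    "r = (\<lambda>i. u i - t *\<^sub>R e i)" "r' = (\<lambda>i. v i - t *\<^sub>R f i)"
  have qr: "(\<lambda>i. q i - r i) = (\<lambda>i. t *\<^sub>R (e (i - 1) + e i))"
    and qr': "(\<lambda>i. q' i - r' i) = (\<lambda>i. t *\<^sub>R (f (i - 1) + f i))"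
    by (simp_all add: defs algebra_simps)
  \<comment> \<open>Polarization for an antisymmetric bilinear form; each difference on the right is
    a sum of adjacent terms, as \<open>alt_form_adjacent_odd\<close> requires.\<close>
  have "2 * (alt_form n q q' - alt_form n r r') =
      alt_form n (\<lambda>i. q i - r i) (\<lambda>i. q' i + r' i) - alt_form n (\<lambda>i. q' i - r' i) (\<lambda>i. q i + r i)"
    using alt_form_swap[of n q q'] alt_form_swap[of n r r'] alt_form_swap[of n q r'] alt_form_swap[of n r q']
      alt_form_swap[of n "\<lambda>i. q i + r i" q'] alt_form_swap[of n "\<lambda>i. q i + r i" r']
      alt_form_swap[of n "\<lambda>i. q' i + r' i" q] alt_form_swap[of n "\<lambda>i. q' i + r' i" r]
    by (simp add: alt_form_add_left alt_form_diff_left)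
  also have "\<dots> = t * ((\<Sum>j = 1..n. (e (j - 1) - e j) \<bullet> (q' j + r' j)) - (\<Sum>j = 1..n. (f (j - 1) - f j) \<bullet> (q j + r j)))"
    unfolding qr qr' alt_form_scaleR_left
      alt_form_adjacent_odd[OF n, of e, OF e] alt_form_adjacent_odd[OF n, of f, OF f]
    by (simp add: algebra_simps)
  \<comment> \<open>Here \<open>q' + r'\<close> is \<open>2 v\<close> plus t times the differences
    of \<open>f\<close>, and likewise for \<open>q + r\<close>. The terms of order t squared pair
    differences of \<open>e\<close> with those of \<open>f\<close>, symmetrically, and
    cancel.\<close>
  also have "\<dots> = 2 * (t * ((\<Sum>j = 1..n. (e (j - 1) - e j) \<bullet> v j) - (\<Sum>j = 1..n. (f (j - 1) - f j) \<bullet> u j)))"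
    by (simp add: defs sum_distrib_left sum_subtractf[symmetric] inner_simps inner_commute algebra_simps
        del: sum_subtractf)
  finally show ?thesis
    by (simp add: defs)
qed

lemma omega_alt_form:
  "omega P u v = alt_form CARD('n) (\<lambda>k. u $ of_nat k) (\<lambda>k. v $ of_nat k)"
  for P u v :: "'n::nontriv ngon"
  by (simp add: omega_def alt_form_def wedge_def dx_def dy_def inner_vec_def sum_2 algebra_simps)

text \<open>For distinct vertices i and i + 1, this is the differential in direction
  \<open>u\<close> of the unit vector from the former to the latter.\<close>

definition edge_deriv :: "('n::nontriv) ngon \<Rightarrow> 'n ngon \<Rightarrow> 'n mod_ring \<Rightarrow> real ^ 2" where
  "edge_deriv P u i = sgn_deriv (P $ (i + 1) - P $ i) (u $ (i + 1) - u $ i)"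

lemma has_derivative_sgn_edge:
  fixes P :: "('n::nontriv) ngon"
  assumes "P $ i \<noteq> P $ j"
  shows "((\<lambda>P. P $ i + t *\<^sub>R sgn (P $ i - P $ j)) has_derivative
           (\<lambda>u. u $ i + t *\<^sub>R sgn_deriv (P $ i - P $ j) (u $ i - u $ j))) (at P)"
proof -
  have lin: "((\<lambda>P :: 'n ngon. P $ k) has_derivative (\<lambda>u. u $ k)) (at P)" for k
    by (intro bounded_linear_imp_has_derivative bounded_linear_vec_nth)
  have "((\<lambda>P. sgn (P $ i - P $ j)) has_derivative (\<lambda>u. sgn_deriv (P $ i - P $ j) (u $ i - u $ j))) (at P)"
    using assms by (intro has_derivative_compose[OF has_derivative_diff[OF lin lin] has_derivative_sgn]) simp
  then show ?thesis
    by (intro has_derivative_add lin has_derivative_scaleR_right)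
qed

lemma q_map_has_derivative:
  fixes P :: "('n::nontriv) ngon"
  assumes "P \<in> nondeg_ngons"
  shows "(q_map t has_derivative (\<lambda>u. \<chi> i. u $ i + t *\<^sub>R edge_deriv P u (i - 1))) (at P)"
proof (rule has_derivative_vec_lambda)
  fix i
  have "P $ (i - 1) \<noteq> P $ (i - 1 + 1)"
    using assms unfolding nondeg_ngons_def by blast
  then show "((\<lambda>P. q_map t P $ i) has_derivative
      (\<lambda>u. (\<chi> i. u $ i + t *\<^sub>R edge_deriv P u (i - 1)) $ i)) (at P)"
    using has_derivative_sgn_edge[of P i "i - 1" t]
    by (simp add: q_map_def edge_deriv_def sgn_div_norm)
qed

lemma r_map_has_derivative:
  fixes P :: "('n::nontriv) ngon"
  assumes "P \<in> nondeg_ngons"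
  shows "(r_map t has_derivative (\<lambda>u. \<chi> i. u $ i - t *\<^sub>R edge_deriv P u i)) (at P)"
proof (rule has_derivative_vec_lambda)
  fix i
  \<comment> \<open>\<open>r_map\<close> uses the reversed edge; reversing both the edge and its
    variation flips the sign, so both maps share \<open>edge_deriv\<close>.\<close>
  have "sgn_deriv (P $ i - P $ (i + 1)) (u $ i - u $ (i + 1)) = - edge_deriv P u i" for u
    using sgn_deriv_minus[of "P $ (i + 1) - P $ i" "u $ (i + 1) - u $ i"] by (simp add: edge_deriv_def)
  then show "((\<lambda>P. r_map t P $ i) has_derivative
      (\<lambda>u. (\<chi> i. u $ i - t *\<^sub>R edge_deriv P u i) $ i)) (at P)"
    using assms has_derivative_sgn_edge[of P i "i + 1" t]
    by (simp add: r_map_def nondeg_ngons_def sgn_div_norm)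
qed

text \<open>Cyclic summation by parts has no boundary term and pairs the edge variations of
  \<open>v\<close> with the Hessian applied to those of \<open>u\<close>; symmetry of the Hessian
  then exchanges \<open>u\<close> and \<open>v\<close>.\<close>

lemma sum_edge_deriv_symmetric:
  fixes P u v :: "('n::nontriv) ngon"
  shows "(\<Sum>i\<in>UNIV. (edge_deriv P u (i - 1) - edge_deriv P u i) \<bullet> v $ i) =
         (\<Sum>i\<in>UNIV. (edge_deriv P v (i - 1) - edge_deriv P v i) \<bullet> u $ i)"
proof -
  have parts: "(\<Sum>i\<in>UNIV. (edge_deriv P u (i - 1) - edge_deriv P u i) \<bullet> v $ i) =
      (\<Sum>i\<in>UNIV. (v $ (i + 1) - v $ i) \<bullet> edge_deriv P u i)" for u v :: "'n ngon"
  proof -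
    have "(\<Sum>i\<in>UNIV. edge_deriv P u (i - 1) \<bullet> v $ i) = (\<Sum>i\<in>UNIV. edge_deriv P u i \<bullet> v $ (i + 1))"
      by (rule sum.reindex_bij_witness[of _ "\<lambda>i. i + 1" "\<lambda>i. i - 1"]) auto
    then show ?thesis
      by (simp add: inner_diff_left inner_diff_right sum_subtractf inner_commute)
  qed
  show ?thesis
    unfolding parts by (simp add: edge_deriv_def sgn_deriv_symmetric)
qed

theorem lemma3p5:
  fixes t :: real
  assumes "CARD('n::nontriv) \<ge> 3" and "odd CARD('n)" and "t > 0"
  shows "\<forall>P \<in> (nondeg_ngons :: 'n ngon set). \<forall>u v.
           pullback (q_map t) omega P u v = pullback (r_map t) omega P u v"
proof (intro ballI allI)
  fix P u v :: "'n ngon"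
  assume P: "P \<in> nondeg_ngons"
  define e where "e w k = edge_deriv P w (of_nat k)" for w and k :: nat
  have periodic: "e w CARD('n) = e w 0" for w
    by (simp add: e_def)
  \<comment> \<open>Since k is at least 1, natural subtraction agrees with that modulo n; for k = 1
    it gives index 0, the edge leaving the vertex labelled n.\<close>
  have pred: "edge_deriv P w (of_nat k - 1) = e w (k - 1)" if "k \<in> {1..CARD('n)}" for w k
    using that by (simp add: e_def of_nat_diff)
  have sum_e: "(\<Sum>k = 1..CARD('n). (e w (k - 1) - e w k) \<bullet> z $ of_nat k) =
      (\<Sum>i\<in>UNIV. (edge_deriv P w (i - 1) - edge_deriv P w i) \<bullet> z $ i)" for w z
    by (subst sum_of_nat_mod_ring[symmetric]) (intro sum.cong refl, simp add: pred, simp add: e_def)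
  have "pullback (q_map t) omega P u v = alt_form CARD('n)
      (\<lambda>k. u $ of_nat k + t *\<^sub>R edge_deriv P u (of_nat k - 1))
      (\<lambda>k. v $ of_nat k + t *\<^sub>R edge_deriv P v (of_nat k - 1))"
    using frechet_derivative_at[OF q_map_has_derivative[OF P, of t], symmetric]
    by (simp add: pullback_def omega_alt_form)
  also have "\<dots> = alt_form CARD('n)
      (\<lambda>k. u $ of_nat k + t *\<^sub>R e u (k - 1)) (\<lambda>k. v $ of_nat k + t *\<^sub>R e v (k - 1))"
    unfolding alt_form_def by (intro sum.cong refl) (simp add: pred)
  also have "\<dots> = alt_form CARD('n)
      (\<lambda>k. u $ of_nat k - t *\<^sub>R e u k) (\<lambda>k. v $ of_nat k - t *\<^sub>R e v k)"
    \<comment> \<open>The difference of the two sides is t times a difference of two cyclic sums,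
      which are equal by \<open>sum_edge_deriv_symmetric\<close>.\<close>
    using alt_form_shift_diff[OF assms(2) periodic[of u] periodic[of v],
        where u = "\<lambda>k. u $ of_nat k" and v = "\<lambda>k. v $ of_nat k" and t = t]
    unfolding sum_e sum_edge_deriv_symmetric[of P u v] by simp
  also have "\<dots> = pullback (r_map t) omega P u v"
    using frechet_derivative_at[OF r_map_has_derivative[OF P, of t], symmetric]
    by (simp add: pullback_def omega_alt_form e_def)
  finally show "pullback (q_map t) omega P u v = pullback (r_map t) omega P u v" .
qed

end
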